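(* Let $\Omega\neq\emptyset$ be a compact metric space, let $T:\Omega\to\Omega$ be a minimal homeomorphism, let $l\in\mathbb{N}$, and let $D,V:\Omega\to M(l,\mathbb{R})$ be continuous maps such that $D(\omega)$ and $V(\omega)$ are symmetric and $D(\omega)$ is invertible for each $\omega\in\Omega$. For $\omega\in\Omega$ let $H_\omega$ be the bounded (self-adjoint) operator on $\ell^2(\mathbb{Z};\mathbb{C}^l)$ given by $$[H_\omega \mathbf{u}]_n = D(T^{n-1}\omega)\mathbf{u}_{n-1}+D(T^n\omega)\mathbf{u}_{n+1}+V(T^n\omega)\mathbf{u}_n,\qquad n\in\mathbb{Z},$$ and for $z\in\mathbb{C}$ let $(T,A(z,\cdot))$ be the associated Jacobi cocycle, with $$A(z,\omega)=\begin{bmatrix} D(T\omega)^{-1}(z-V(T\omega)) & -D(T\omega)^{-1}\\ D(T\omega) & 0\end{bmatrix}\in SL(2l,\mathbb{C}).$$ Then, for each $\omega\in\Omega$, $$\rho(H_\omega)\subseteq\{z\in\mathbb{C}\mid (T,A(z,\cdot))\in\mathcal{UG}\}.$$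
   Context: $M(l,\mathbb{R})$ is the space of $l\times l$ real matrices; $\rho(H_\omega)$ is the resolvent set of $H_\omega$ as an operator on $\ell^2(\mathbb{Z};\mathbb{C}^l)$. A homeomorphism $T$ of $\Omega$ is minimal if every orbit $\{T^j\omega\mid j\in\mathbb{Z}\}$ is dense in $\Omega$. $\mathbb{N}=\{1,2,\dots\}$. An $SL(2l,\mathbb{C})$-cocycle over a compact metric space $\Omega$ is a pair $(T,A)$, where $T:\Omega\to\Omega$ is a homeomorphism and $A:\Omega\to SL(2l,\mathbb{C})$ is continuous, acting on $\Omega\times\mathbb{C}^{2l}$ by $(\omega,\mathbf{u})\mapsto(T\omega,A(\omega)\mathbf{u})$. Its iterates are given by $A_n(\omega)=A(T^{n-1}\omega)\cdots A(T\omega)A(\omega)$ for $n\ge1$, $A_0(\omega)=\mathbb{I}_{2l}$, and $A_n(\omega)=A(T^{n}\omega)^{-1}\cdots A(T^{-2}\omega)^{-1}A(T^{-1}\omega)^{-1}$ for $n\le-1$. The cocycle $(T,A)$ satisfies the uniform exponential growth condition, written $(T,A)\in\mathcal{UG}$, if there exist constants $\beta>0$ and $\lambda>1$ such that for each $\omega\in\Omega$ and each $\mathbf{v}\in\mathbb{C}^{2l}\setminus\{\mathbf{0}\}$, either $\|A_n(\omega)\mathbf{v}\|\ge\beta\lambda^n\|\mathbf{v}\|$ for all $n\in\mathbb{N}$, or $\|A_{-n}(\omega)\mathbf{v}\|\ge\beta\lambda^n\|\mathbf{v}\|$ for all $n\in\mathbb{N}$. *)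

theory Defs
  imports "HOL-Analysis.Analysis"
begin

definition self_homeomorphism :: "'w::topological_space set \<Rightarrow> ('w \<Rightarrow> 'w) \<Rightarrow> bool" where
  "self_homeomorphism \<Omega> T \<longleftrightarrow> (\<exists>S. homeomorphism \<Omega> \<Omega> T S)"

(* T^j for integer j. The inverse of T is the inverse on \<Omega>, since T is only bijective there. *)
definition iter_int :: "'w set \<Rightarrow> ('w \<Rightarrow> 'w) \<Rightarrow> int \<Rightarrow> 'w \<Rightarrow> 'w" where
  "iter_int \<Omega> T j \<omega> =
     (if 0 \<le> j then (T ^^ nat j) \<omega> else (inv_into \<Omega> T ^^ nat (- j)) \<omega>)"

definition minimal_homeomorphism :: "'w::topological_space set \<Rightarrow> ('w \<Rightarrow> 'w) \<Rightarrow> bool" where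
  "minimal_homeomorphism \<Omega> T \<longleftrightarrow>
     self_homeomorphism \<Omega> T \<and> (\<forall>\<omega>\<in>\<Omega>. \<Omega> \<subseteq> closure (range (\<lambda>j. iter_int \<Omega> T j \<omega>)))"

definition SL_cocycle ::
    "'w::topological_space set \<Rightarrow> ('w \<Rightarrow> 'w) \<Rightarrow> ('w \<Rightarrow> complex ^ 'n ^ 'n) \<Rightarrow> bool" where
  "SL_cocycle \<Omega> T A \<longleftrightarrow>
     self_homeomorphism \<Omega> T \<and> continuous_on \<Omega> A \<and> (\<forall>\<omega>\<in>\<Omega>. det (A \<omega>) = 1)"

primrec cocycle_fwd ::
    "'w set \<Rightarrow> ('w \<Rightarrow> 'w) \<Rightarrow> ('w \<Rightarrow> complex ^ 'n ^ 'n) \<Rightarrow> nat \<Rightarrow> 'w \<Rightarrow> complex ^ 'n ^ 'n" where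
  "cocycle_fwd \<Omega> T A 0 \<omega> = mat 1"
| "cocycle_fwd \<Omega> T A (Suc n) \<omega> = A (iter_int \<Omega> T (int n) \<omega>) ** cocycle_fwd \<Omega> T A n \<omega>"

(* A_{-n}; matrix_inv is the true inverse because a cocycle has determinant 1 on \<Omega> *)
primrec cocycle_bwd ::
    "'w set \<Rightarrow> ('w \<Rightarrow> 'w) \<Rightarrow> ('w \<Rightarrow> complex ^ 'n ^ 'n) \<Rightarrow> nat \<Rightarrow> 'w \<Rightarrow> complex ^ 'n ^ 'n" where
  "cocycle_bwd \<Omega> T A 0 \<omega> = mat 1"
| "cocycle_bwd \<Omega> T A (Suc n) \<omega> =
     matrix_inv (A (iter_int \<Omega> T (- int (Suc n)) \<omega>)) ** cocycle_bwd \<Omega> T A n \<omega>"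

definition cocycle_iter ::
    "'w set \<Rightarrow> ('w \<Rightarrow> 'w) \<Rightarrow> ('w \<Rightarrow> complex ^ 'n ^ 'n) \<Rightarrow> int \<Rightarrow> 'w \<Rightarrow> complex ^ 'n ^ 'n" where
  "cocycle_iter \<Omega> T A n \<omega> =
     (if 0 \<le> n then cocycle_fwd \<Omega> T A (nat n) \<omega> else cocycle_bwd \<Omega> T A (nat (- n)) \<omega>)"

definition UG :: "'w::topological_space set \<Rightarrow> (('w \<Rightarrow> 'w) \<times> ('w \<Rightarrow> complex ^ 'n ^ 'n)) set" where
  "UG \<Omega> = {(T, A). SL_cocycle \<Omega> T A \<and>
     (\<exists>\<beta> > 0. \<exists>r > 1. \<forall>\<omega>\<in>\<Omega>. \<forall>v. v \<noteq> 0 \<longrightarrow>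
        (\<forall>n::nat. n \<ge> 1 \<longrightarrow> norm (cocycle_iter \<Omega> T A (int n) \<omega> *v v) \<ge> \<beta> * r ^ n * norm v) \<or>
        (\<forall>n::nat. n \<ge> 1 \<longrightarrow> norm (cocycle_iter \<Omega> T A (- int n) \<omega> *v v) \<ge> \<beta> * r ^ n * norm v))}"

definition ell2 :: "(int \<Rightarrow> complex ^ 'l) set" where
  "ell2 = {u. (\<lambda>n. (norm (u n))\<^sup>2) summable_on UNIV}"

definition ell2_norm :: "(int \<Rightarrow> complex ^ 'l) \<Rightarrow> real" where
  "ell2_norm u = sqrt (\<Sum>\<^sub>\<infinity>n. (norm (u n))\<^sup>2)"

definition ell2_bounded_op ::
    "((int \<Rightarrow> complex ^ 'l) \<Rightarrow> (int \<Rightarrow> complex ^ 'l)) \<Rightarrow> bool" where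
  "ell2_bounded_op B \<longleftrightarrow>
     (\<forall>u\<in>ell2. B u \<in> ell2) \<and>
     (\<forall>u\<in>ell2. \<forall>v\<in>ell2. B (\<lambda>n. u n + v n) = (\<lambda>n. B u n + B v n)) \<and>
     (\<forall>c. \<forall>u\<in>ell2. B (\<lambda>n. c *s u n) = (\<lambda>n. c *s B u n)) \<and>
     (\<exists>C. \<forall>u\<in>ell2. ell2_norm (B u) \<le> C * ell2_norm u)"

definition resolvent_set ::
    "((int \<Rightarrow> complex ^ 'l) \<Rightarrow> (int \<Rightarrow> complex ^ 'l)) \<Rightarrow> complex set" where
  "resolvent_set H = {z. let B = (\<lambda>u n. z *s u n - H u n) in
     bij_betw B ell2 ell2 \<and> ell2_bounded_op (inv_into ell2 B)}"

abbreviation complex_matrix :: "real ^ 'm ^ 'n \<Rightarrow> complex ^ 'm ^ 'n" where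
  "complex_matrix \<equiv> map_matrix complex_of_real"

definition jacobi_op ::
    "'w set \<Rightarrow> ('w \<Rightarrow> 'w) \<Rightarrow> ('w \<Rightarrow> real ^ 'l ^ 'l) \<Rightarrow> ('w \<Rightarrow> real ^ 'l ^ 'l) \<Rightarrow> 'w \<Rightarrow>
     (int \<Rightarrow> complex ^ 'l) \<Rightarrow> (int \<Rightarrow> complex ^ 'l)" where
  "jacobi_op \<Omega> T D V \<omega> u n =
     complex_matrix (D (iter_int \<Omega> T (n - 1) \<omega>)) *v u (n - 1) +
     complex_matrix (D (iter_int \<Omega> T n \<omega>)) *v u (n + 1) +
     complex_matrix (V (iter_int \<Omega> T n \<omega>)) *v u n"

definition block_matrix ::
    "'a ^ 'l ^ 'l \<Rightarrow> 'a ^ 'l ^ 'l \<Rightarrow> 'a ^ 'l ^ 'l \<Rightarrow> 'a ^ 'l ^ 'l \<Rightarrow> 'a ^ ('l + 'l) ^ ('l + 'l)" where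
  "block_matrix P Q R S = (\<chi> i j. case i of
       Inl a \<Rightarrow> (case j of Inl b \<Rightarrow> P $ a $ b | Inr b \<Rightarrow> Q $ a $ b)
     | Inr a \<Rightarrow> (case j of Inl b \<Rightarrow> R $ a $ b | Inr b \<Rightarrow> S $ a $ b))"

definition jacobi_cocycle ::
    "('w \<Rightarrow> 'w) \<Rightarrow> ('w \<Rightarrow> real ^ 'l ^ 'l) \<Rightarrow> ('w \<Rightarrow> real ^ 'l ^ 'l) \<Rightarrow> complex \<Rightarrow> 'w \<Rightarrow>
     complex ^ ('l + 'l) ^ ('l + 'l)" where
  "jacobi_cocycle T D V z \<omega> =
     block_matrix
       (matrix_inv (complex_matrix (D (T \<omega>))) ** (mat z - complex_matrix (V (T \<omega>))))
       (- matrix_inv (complex_matrix (D (T \<omega>))))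
       (complex_matrix (D (T \<omega>)))
       0"

end

theory Submission
  imports Defs
begin

text \<open>
  If \<open>z\<close> lies in the resolvent set for one base point, then \<open>z - H\<close> is bounded below on finitely
  supported sequences at that point. The bound is invariant under shifts, hence holds along the whole
  orbit with the same constant; the orbit is dense and the inequality for a fixed test sequence is a
  closed condition on the base point, so the bound holds on all of \<open>\<Omega>\<close> with one constant
  (\<open>jacobi_bounded_below_uniformly\<close>). Spectral theory enters nowhere else.

  An orbit \<open>W n\<close> of the cocycle encodes a formal solution \<open>u\<close> of \<open>H u = z u\<close>. Testing the lower bound on
  \<open>u\<close> cut off to a finite window produces errors at the two ends only, and gives an estimate
  \<open>\<delta> (\<Sum>n=a..b. \<parallel>W n\<parallel>\<^sup>2) \<le> \<parallel>W a\<parallel>\<^sup>2 + \<parallel>W b\<parallel>\<^sup>2\<close> for all \<open>a \<le> b\<close>, with \<open>\<delta>\<close> independent of the orbit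
  (\<open>truncated_solution_estimate\<close>).

  The rest is a fact about positive two-sided sequences (\<open>exponential_growth_dichotomy\<close>). Such an
  estimate forces, for a fixed large \<open>N\<close>, one of the two values at distance \<open>N\<close> from any site to be at
  least twice the value at the site. Once the sequence has doubled in one direction it must
  keep doubling in that direction, since the smaller value behind cannot meet the demand.
  Uniform bounds for one step of the cocycle and of its inverse, available by compactness, turn
  doubling every \<open>N\<close> steps into exponential growth at every step.
\<close>

section \<open>Exponential growth of sequences controlled by their end values\<close>

text \<open>
  Keeping a single term of the sum gives \<open>\<delta> w\<^sub>k \<le> w\<^sub>k\<^sub>-\<^sub>m + w\<^sub>k\<^sub>+\<^sub>m\<close> for every \<open>m\<close>.
  Adding these bounds over \<open>m = 1, \<dots>, N\<close> and applying the hypothesis to the resulting sum once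
  more yields a bound whose constant grows with \<open>N\<close>; without the factor \<open>N\<close> no growth could be
  extracted.
\<close>

lemma sum_control_two_point_bound:
  fixes w :: "int \<Rightarrow> real" and \<delta> :: real
  assumes pos: "\<And>n. 0 \<le> w n" and \<delta>: "0 < \<delta>"
    and bd: "\<And>a b. a \<le> b \<Longrightarrow> \<delta> * (\<Sum>n=a..b. w n) \<le> w a + w b"
  shows "\<delta>\<^sup>2 * real N * w k \<le> w (k - int N) + w (k + int N)"
proof -
  have pt: "\<delta> * w k \<le> w (k - int m) + w (k + int m)" for m
  proof -
    have "w k \<le> (\<Sum>n=k - int m..k + int m. w n)"
      by (rule member_le_sum) (use pos in auto)
    then have "\<delta> * w k \<le> \<delta> * (\<Sum>n=k - int m..k + int m. w n)"
      using \<delta> by simp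
    also have "\<dots> \<le> w (k - int m) + w (k + int m)"
      by (rule bd) simp
    finally show ?thesis .
  qed
  have "real N * (\<delta> * w k) = (\<Sum>m\<in>{1..N}. \<delta> * w k)" by simp
  also have "\<dots> \<le> (\<Sum>m\<in>{1..N}. w (k - int m) + w (k + int m))"
    by (intro sum_mono pt)
  also have "\<dots> = (\<Sum>n\<in>(\<lambda>m. k - int m) ` {1..N}. w n) + (\<Sum>n\<in>(\<lambda>m. k + int m) ` {1..N}. w n)"
    by (simp add: sum.distrib sum.reindex inj_on_def)
  also have "\<dots> = (\<Sum>n\<in>(\<lambda>m. k - int m) ` {1..N} \<union> (\<lambda>m. k + int m) ` {1..N}. w n)"
    by (rule sum.union_disjoint[symmetric]) auto
  also have "\<dots> \<le> (\<Sum>n=k - int N..k + int N. w n)"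
    by (rule sum_mono2) (use pos in auto)
  finally have "\<delta> * (real N * (\<delta> * w k)) \<le> \<delta> * (\<Sum>n=k - int N..k + int N. w n)"
    using \<delta> by simp
  also have "\<dots> \<le> w (k - int N) + w (k + int N)"
    by (rule bd) simp
  finally show ?thesis by (simp add: power2_eq_square mult_ac)
qed

text \<open>
  On the grid \<open>N\<int>\<close>, the two-neighbour bound with constant \<open>8\<close> propagates growth: if the value at a
  grid point is at most a quarter of the next one, it cannot supply half of what the
  next point demands from its two neighbours, so the following grid value is again at least four
  times larger. The bound \<open>w n \<le> M w (n+1)\<close> fills the gaps between grid points, at the cost of the
  factor \<open>M ^ N\<close>.
\<close>

lemma growth_in_one_direction:
  fixes w :: "int \<Rightarrow> real"
  assumes pos: "\<And>n. 0 < w n" and M: "1 \<le> M"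
    and slow: "\<And>n. w n \<le> M * w (n + 1)"
    and conv: "\<And>k. 8 * w k \<le> w (k - int N) + w (k + int N)"
    and start: "4 * w 0 \<le> w (int N)" and N: "0 < N"
  shows "4 ^ (n div N) * w 0 \<le> M ^ N * w (int n)"
proof -
  have step: "4 * w (int N * int j) \<le> w (int N * int (Suc j))" for j
  proof (induction j)
    case 0
    then show ?case using start by simp
  next
    case (Suc j)
    have "8 * w (int N * int (Suc j)) \<le> w (int N * int j) + w (int N * int (Suc (Suc j)))"
      using conv[of "int N * int (Suc j)"] by (simp add: algebra_simps)
    with Suc pos[of "int N * int (Suc j)"] show ?case by linarith
  qed
  have grid: "4 ^ j * w 0 \<le> w (int N * int j)" for j
  proof (induction j)
    case (Suc j)
    then show ?case using step[of j] by simp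
  qed simp
  have fill: "w m \<le> M ^ r * w (m + int r)" for m r
  proof (induction r)
    case (Suc r)
    have "w m \<le> M ^ r * w (m + int r)" by (rule Suc)
    also have "\<dots> \<le> M ^ r * (M * w (m + int r + 1))"
      by (intro mult_left_mono slow) (use M in auto)
    finally show ?case by (simp add: algebra_simps)
  qed simp
  have "4 ^ (n div N) * w 0 \<le> w (int N * int (n div N))" by (rule grid)
  also have "\<dots> \<le> M ^ (n mod N) * w (int N * int (n div N) + int (n mod N))" by (rule fill)
  also have "int N * int (n div N) + int (n mod N) = int n"
    by (metis mult_div_mod_eq of_nat_add of_nat_mult)
  also have "M ^ (n mod N) * w (int n) \<le> M ^ N * w (int n)"
    by (intro mult_right_mono power_increasing) (use M N pos[of "int n"] in \<open>auto simp: less_imp_le\<close>)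
  finally show ?thesis .
qed

text \<open>
  The constants \<open>\<beta>\<close> and \<open>r\<close> depend only on \<open>\<delta>\<close> and \<open>M\<close>, never on the sequence. This is what makes
  the growth uniform when the lemma is applied to all orbits of a cocycle.
\<close>

lemma exponential_growth_dichotomy:
  fixes \<delta> M :: real
  assumes \<delta>: "0 < \<delta>" and M: "1 \<le> M"
  shows "\<exists>\<beta>>0. \<exists>r>1. \<forall>x :: int \<Rightarrow> real.
     (\<forall>n. 0 < x n \<and> x n \<le> M * x (n + 1) \<and> x (n + 1) \<le> M * x n) \<longrightarrow>
     (\<forall>a b. a \<le> b \<longrightarrow> \<delta> * (\<Sum>n=a..b. (x n)\<^sup>2) \<le> (x a)\<^sup>2 + (x b)\<^sup>2) \<longrightarrow>
     (\<forall>n. \<beta> * r ^ n * x 0 \<le> x (int n)) \<or> (\<forall>n. \<beta> * r ^ n * x 0 \<le> x (- int n))"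
proof -
  obtain N :: nat where N_large: "8 / \<delta>\<^sup>2 < real N" using reals_Archimedean2 by blast
  have "0 < 8 / \<delta>\<^sup>2" using \<delta> by simp
  then have "0 < real N" using N_large by (rule less_trans)
  then have N: "0 < N" by simp
  have N8: "8 \<le> \<delta>\<^sup>2 * real N"
    using N_large \<delta> by (simp add: divide_less_eq mult.commute)
  \<comment> \<open>The squares grow by \<open>4\<close> over \<open>N\<close> steps, so the sequence itself grows by \<open>2\<close>.\<close>
  define r where "r = root N 2"
  have r1: "1 < r" and rN: "r ^ N = 2" using N by (auto simp: r_def)
  \<comment> \<open>\<open>M ^ N\<close> pays for the steps off the grid, the factor \<open>2\<close> for rounding \<open>n / N\<close> down.\<close>
  define \<beta> where "\<beta> = 1 / (2 * M ^ N)"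
  have Mpos: "0 < M ^ N" using M by simp
  have \<beta>: "0 < \<beta>" using Mpos by (simp add: \<beta>_def)
  have rpow: "r ^ n \<le> 2 * 2 ^ (n div N)" for n
  proof -
    have "r ^ n = r ^ (N * (n div N) + n mod N)" by simp
    also have "\<dots> = 2 ^ (n div N) * r ^ (n mod N)" by (simp only: power_add power_mult rN)
    also have "r ^ (n mod N) \<le> r ^ N"
      by (intro power_increasing) (use N r1 in \<open>auto simp: less_imp_le\<close>)
    finally show ?thesis using rN by (simp add: mult.commute)
  qed
  have half: "\<beta> * r ^ n * x 0 \<le> x (int n)"
    if pos: "\<And>n. 0 < x n" and slow: "\<And>n. x n \<le> M * x (n + 1)"
      and conv: "\<And>k. 8 * (x k)\<^sup>2 \<le> (x (k - int N))\<^sup>2 + (x (k + int N))\<^sup>2"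
      and start: "4 * (x 0)\<^sup>2 \<le> (x (int N))\<^sup>2" for x :: "int \<Rightarrow> real" and n
  proof -
    have "4 ^ (n div N) * (x 0)\<^sup>2 \<le> (M\<^sup>2) ^ N * (x (int n))\<^sup>2"
    proof (rule growth_in_one_direction[where w = "\<lambda>n. (x n)\<^sup>2", OF _ _ _ conv start N])
      show "(x n)\<^sup>2 \<le> M\<^sup>2 * (x (n + 1))\<^sup>2" for n
        using power_mono[OF slow[of n], of 2] pos[of n] by (simp add: power_mult_distrib less_imp_le)
    qed (use pos M in \<open>auto simp: one_le_power less_imp_neq[THEN not_sym]\<close>)
    moreover have "(4::real) ^ (n div N) = (2 ^ (n div N))\<^sup>2"
      by (simp add: power2_eq_square flip: power_mult_distrib)
    ultimately have "(2 ^ (n div N) * x 0)\<^sup>2 \<le> (M ^ N * x (int n))\<^sup>2"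
      by (simp add: power_mult_distrib mult.commute flip: power_mult)
    then have "2 ^ (n div N) * x 0 \<le> M ^ N * x (int n)"
      by (rule power2_le_imp_le) (use Mpos pos[of "int n"] in simp)
    moreover have "r ^ n * x 0 \<le> 2 * 2 ^ (n div N) * x 0"
      by (intro mult_right_mono rpow less_imp_le pos)
    ultimately have "r ^ n * x 0 \<le> 2 * M ^ N * x (int n)" by linarith
    then show ?thesis using Mpos by (simp add: \<beta>_def field_simps)
  qed
  show ?thesis
  proof (rule exI[of _ \<beta>], intro conjI \<beta>, rule exI[of _ r], intro conjI allI impI r1)
    fix x :: "int \<Rightarrow> real"
    assume x: "\<forall>n. 0 < x n \<and> x n \<le> M * x (n + 1) \<and> x (n + 1) \<le> M * x n"
      and bd: "\<forall>a b. a \<le> b \<longrightarrow> \<delta> * (\<Sum>n=a..b. (x n)\<^sup>2) \<le> (x a)\<^sup>2 + (x b)\<^sup>2"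
    have pos: "0 < x n" and up: "x n \<le> M * x (n + 1)" and down: "x (n + 1) \<le> M * x n" for n
      using x by auto
    have conv: "8 * (x k)\<^sup>2 \<le> (x (k - int N))\<^sup>2 + (x (k + int N))\<^sup>2" for k
    proof -
      have "8 * (x k)\<^sup>2 \<le> \<delta>\<^sup>2 * real N * (x k)\<^sup>2" by (intro mult_right_mono N8) simp
      also have "\<dots> \<le> (x (k - int N))\<^sup>2 + (x (k + int N))\<^sup>2"
        by (rule sum_control_two_point_bound[where w = "\<lambda>n. (x n)\<^sup>2", OF _ \<delta> bd[rule_format]]) auto
      finally show ?thesis .
    qed
    \<comment> \<open>The larger neighbour of \<open>0\<close> carries at least half of the bound and fixes the direction of
      growth; the backward case is the forward one for the reflected sequence.\<close>
    consider "4 * (x 0)\<^sup>2 \<le> (x (int N))\<^sup>2" | "4 * (x 0)\<^sup>2 \<le> (x (- int N))\<^sup>2"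
      using conv[of 0] by fastforce
    then show "(\<forall>n. \<beta> * r ^ n * x 0 \<le> x (int n)) \<or> (\<forall>n. \<beta> * r ^ n * x 0 \<le> x (- int n))"
    proof cases
      case 1
      then show ?thesis using half[OF pos up conv] by blast
    next
      case 2
      have "\<beta> * r ^ n * x (- 0) \<le> x (- int n)" for n
      proof (rule half[where x = "\<lambda>n. x (- n)"])
        show "x (- n) \<le> M * x (- (n + 1))" for n
        proof -
          have "- (n + 1) + 1 = - n" by simp
          then show ?thesis using down[of "- (n + 1)"] by (simp only:)
        qed
        show "8 * (x (- k))\<^sup>2 \<le> (x (- (k - int N)))\<^sup>2 + (x (- (k + int N)))\<^sup>2" for k
          using conv[of "- k"] by (simp add: algebra_simps)
      qed (use pos 2 in auto)
      then show ?thesis by simp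
    qed
  qed
qed

section \<open>Matrices depending continuously on a parameter\<close>

lemma invertible_matrix_inv:
  fixes A :: "'a::semiring_1 ^ 'n ^ 'n"
  assumes "invertible A"
  shows "A ** matrix_inv A = mat 1" "matrix_inv A ** A = mat 1"
  using someI_ex[OF assms[unfolded invertible_def]] unfolding matrix_inv_def by auto

text \<open>
  The inverse as a quotient of determinants: polynomials in the entries divided by a nonvanishing
  polynomial. Continuity of inversion follows.
\<close>

lemma matrix_inv_cramer:
  fixes A :: "'a::field ^ 'n ^ 'n"
  assumes "invertible A"
  shows "matrix_inv A $ i $ j = det (\<chi> p q. if q = i then axis j 1 $ p else A $ p $ q) / det A"
proof -
  have "A *v (matrix_inv A *v axis j 1) = axis j 1"
    by (simp add: matrix_vector_mul_assoc invertible_matrix_inv[OF assms])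
  then have "matrix_inv A *v axis j 1
      = (\<chi> k. det (\<chi> p q. if q = k then axis j 1 $ p else A $ p $ q) / det A)"
    using cramer assms invertible_det_nz by blast
  then have "(matrix_inv A *v axis j 1) $ i
      = det (\<chi> p q. if q = i then axis j 1 $ p else A $ p $ q) / det A" by simp
  then show ?thesis
    by (simp add: matrix_vector_mult_def axis_def if_distrib cong: if_cong)
qed

lemma continuous_on_det:
  fixes A :: "'w::topological_space \<Rightarrow> 'a::real_normed_field ^ 'n ^ 'n"
  assumes "\<And>i j. continuous_on S (\<lambda>w. A w $ i $ j)"
  shows "continuous_on S (\<lambda>w. det (A w))"
  unfolding det_def by (intro continuous_intros assms)

lemma continuous_on_matrix_inv:
  fixes A :: "'w::topological_space \<Rightarrow> complex ^ 'n ^ 'n"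
  assumes cont: "continuous_on S A" and inv: "\<And>w. w \<in> S \<Longrightarrow> invertible (A w)"
  shows "continuous_on S (\<lambda>w. matrix_inv (A w))"
proof -
  have ent: "continuous_on S (\<lambda>w. A w $ i $ j)" for i j
    by (intro continuous_intros cont)
  have "continuous_on S (\<lambda>w. matrix_inv (A w) $ i $ j)" for i j
  proof -
    have "continuous_on S (\<lambda>w. det (\<chi> p q. if q = i then axis j 1 $ p else A w $ p $ q) / det (A w))"
    proof (intro continuous_on_divide continuous_on_det ent)
      show "continuous_on S (\<lambda>w. (\<chi> p q. if q = i then axis j 1 $ p else A w $ p $ q) $ p $ q)" for p q
        by (cases "q = i") (auto intro: ent)
      show "\<forall>w\<in>S. det (A w) \<noteq> 0" using inv invertible_det_nz by blast
    qed
    then show ?thesis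
      by (subst continuous_on_cong[OF refl matrix_inv_cramer[OF inv]])
  qed
  then have "continuous_on S (\<lambda>w. \<chi> i. \<chi> j. matrix_inv (A w) $ i $ j)"
    by (intro continuous_on_vec_lambda)
  then show ?thesis by (simp only: vec_nth_inverse)
qed

lemma continuous_on_matrix_vector_mult:
  fixes A :: "'w::topological_space \<Rightarrow> complex ^ 'm ^ 'n"
  assumes "continuous_on S A"
  shows "continuous_on S (\<lambda>w. A w *v x)"
  unfolding matrix_vector_mult_def by (intro continuous_intros assms)

lemma continuous_on_matrix_mult:
  fixes A :: "'w::topological_space \<Rightarrow> complex ^ 'm ^ 'n" and B :: "'w \<Rightarrow> complex ^ 'k ^ 'm"
  assumes "continuous_on S A" "continuous_on S B"
  shows "continuous_on S (\<lambda>w. A w ** B w)"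
  unfolding matrix_matrix_mult_def by (intro continuous_intros assms)

lemma continuous_on_complex_matrix:
  fixes A :: "'w::topological_space \<Rightarrow> real ^ 'm ^ 'n"
  assumes "continuous_on S A"
  shows "continuous_on S (\<lambda>w. complex_matrix (A w))"
  unfolding map_matrix_def by (intro continuous_intros assms)

lemma invertible_complex_matrix:
  fixes A :: "real ^ 'n ^ 'n"
  assumes "invertible A"
  shows "invertible (complex_matrix A)"
proof -
  have mult: "complex_matrix X ** complex_matrix Y = complex_matrix (X ** Y)" for X Y :: "real ^ 'n ^ 'n"
    by (simp add: vec_eq_iff matrix_matrix_mult_def)
  have one: "complex_matrix (mat 1 :: real ^ 'n ^ 'n) = mat 1"
    by (simp add: vec_eq_iff mat_def)
  show ?thesis
    using assms unfolding invertible_def by (metis mult one)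
qed

lemma norm_matrix_vector_mult_le:
  fixes A :: "complex ^ 'm ^ 'n"
  shows "norm (A *v x) \<le> (\<Sum>i\<in>UNIV. \<Sum>j\<in>UNIV. norm (A $ i $ j)) * norm x"
proof -
  have "norm (A *v x) \<le> (\<Sum>i\<in>UNIV. norm ((A *v x) $ i))"
    unfolding norm_vec_def by (rule L2_set_le_sum) simp
  also have "\<dots> \<le> (\<Sum>i\<in>UNIV. \<Sum>j\<in>UNIV. norm (A $ i $ j) * norm x)"
  proof (rule sum_mono)
    fix i
    have "norm ((A *v x) $ i) \<le> (\<Sum>j\<in>UNIV. norm (A $ i $ j * x $ j))"
      unfolding matrix_vector_mult_def by (simp add: norm_sum)
    also have "\<dots> \<le> (\<Sum>j\<in>UNIV. norm (A $ i $ j) * norm x)"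
      unfolding norm_mult by (intro sum_mono mult_left_mono Finite_Cartesian_Product.norm_nth_le) auto
    finally show "norm ((A *v x) $ i) \<le> (\<Sum>j\<in>UNIV. norm (A $ i $ j) * norm x)" .
  qed
  finally show ?thesis by (simp add: sum_distrib_right)
qed

lemma compact_uniform_matrix_bound:
  fixes A :: "'w::topological_space \<Rightarrow> complex ^ 'm ^ 'n"
  assumes "compact S" "continuous_on S A"
  obtains K where "1 \<le> K" "\<And>w x. w \<in> S \<Longrightarrow> norm (A w *v x) \<le> K * norm x"
proof -
  have "continuous_on S (\<lambda>w. \<Sum>i\<in>UNIV. \<Sum>j\<in>UNIV. norm (A w $ i $ j))"
    by (intro continuous_intros assms)
  then have "bounded ((\<lambda>w. \<Sum>i\<in>UNIV. \<Sum>j\<in>UNIV. norm (A w $ i $ j)) ` S)"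
    by (intro compact_imp_bounded compact_continuous_image assms)
  then obtain K where K: "\<And>w. w \<in> S \<Longrightarrow> (\<Sum>i\<in>UNIV. \<Sum>j\<in>UNIV. norm (A w $ i $ j)) \<le> K"
    unfolding bounded_iff by (metis abs_le_D1 image_eqI real_norm_def)
  show ?thesis
  proof (rule that[of "max K 1"])
    fix w x assume "w \<in> S"
    have "norm (A w *v x) \<le> (\<Sum>i\<in>UNIV. \<Sum>j\<in>UNIV. norm (A w $ i $ j)) * norm x"
      by (rule norm_matrix_vector_mult_le)
    also have "\<dots> \<le> max K 1 * norm x"
      using K[OF \<open>w \<in> S\<close>] by (intro mult_right_mono) auto
    finally show "norm (A w *v x) \<le> max K 1 * norm x" .
  qed auto
qed

section \<open>Two-by-two block matrices and their determinants\<close>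

lemma sum_UNIV_Plus:
  "(\<Sum>i\<in>(UNIV :: ('a::finite + 'b::finite) set). f i) = (\<Sum>a\<in>UNIV. f (Inl a)) + (\<Sum>b\<in>UNIV. f (Inr b))"
  using sum.Plus[of "UNIV :: 'a set" "UNIV :: 'b set" f] by (simp add: UNIV_Plus_UNIV comp_def)

lemma block_matrix_nth [simp]:
  "block_matrix P Q R S $ Inl a $ Inl b = P $ a $ b"
  "block_matrix P Q R S $ Inl a $ Inr b = Q $ a $ b"
  "block_matrix P Q R S $ Inr a $ Inl b = R $ a $ b"
  "block_matrix P Q R S $ Inr a $ Inr b = S $ a $ b"
  by (simp_all add: block_matrix_def)

lemma block_matrix_mult:
  fixes P Q R S :: "'a::semiring_1 ^ 'l ^ 'l"
  shows "block_matrix P Q R S ** block_matrix P' Q' R' S' =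
     block_matrix (P ** P' + Q ** R') (P ** Q' + Q ** S') (R ** P' + S ** R') (R ** Q' + S ** S')"
proof -
  have "(block_matrix P Q R S ** block_matrix P' Q' R' S') $ i $ j =
     block_matrix (P ** P' + Q ** R') (P ** Q' + Q ** S') (R ** P' + S ** R') (R ** Q' + S ** S') $ i $ j" for i j
    by (cases i; cases j) (simp_all add: matrix_matrix_mult_def sum_UNIV_Plus)
  then show ?thesis by (simp add: vec_eq_iff)
qed

lemma transpose_block_matrix:
  "transpose (block_matrix P Q R S) = block_matrix (transpose P) (transpose R) (transpose Q) (transpose S)"
proof -
  have "transpose (block_matrix P Q R S) $ i $ j
      = block_matrix (transpose P) (transpose R) (transpose Q) (transpose S) $ i $ j" for i j
    by (cases i; cases j) (simp_all add: transpose_def)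
  then show ?thesis by (simp add: vec_eq_iff)
qed

text \<open>
  In the Leibniz sum a permutation contributes only if it fixes every lower index, because the
  lower rows are rows of the identity; injectivity then keeps upper indices among the upper ones,
  where the block is again the identity. Only the identity permutation survives.
\<close>

lemma det_upper_shear:
  fixes X :: "'a::comm_ring_1 ^ 'l ^ 'l"
  shows "det (block_matrix (mat 1) X 0 (mat 1)) = 1"
proof -
  let ?U = "block_matrix (mat 1) X 0 (mat 1) :: 'a ^ ('l + 'l) ^ ('l + 'l)"
  have vanish: "(\<Prod>i\<in>UNIV. ?U $ i $ p i) = 0" if "p permutes UNIV" "p \<noteq> id" for p
  proof (rule ccontr)
    assume "(\<Prod>i\<in>UNIV. ?U $ i $ p i) \<noteq> 0"
    then have nz: "?U $ i $ p i \<noteq> 0" for i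
      using prod_zero[of UNIV "\<lambda>i. ?U $ i $ p i"] by auto
    have r: "p (Inr a) = Inr a" for a
      using nz[of "Inr a"] by (cases "p (Inr a)") (auto simp: mat_def split: if_splits)
    have l: "p (Inl a) = Inl a" for a
    proof (cases "p (Inl a)")
      case (Inl b)
      then show ?thesis using nz[of "Inl a"] by (auto simp: mat_def split: if_splits)
    next
      case (Inr b)
      then have "p (Inl a) = p (Inr b)" by (simp add: r)
      then show ?thesis using permutes_inj[OF that(1)] by (auto dest: injD)
    qed
    have "p i = i" for i using l r by (cases i) auto
    then show False using that(2) by auto
  qed
  have "det ?U = (\<Sum>p\<in>{id}. of_int (sign p) * (\<Prod>i\<in>UNIV. ?U $ i $ p i))"
    unfolding det_def by (rule sum.mono_neutral_right) (auto simp: vanish permutes_id)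
  also have "\<dots> = 1"
  proof -
    have "?U $ i $ i = 1" for i by (cases i) (auto simp: mat_def)
    then show ?thesis by simp
  qed
  finally show ?thesis .
qed

lemma det_lower_shear:
  fixes X :: "'a::comm_ring_1 ^ 'l ^ 'l"
  shows "det (block_matrix (mat 1) 0 X (mat 1)) = 1"
proof -
  have "transpose (block_matrix (mat 1) 0 X (mat 1)) = block_matrix (mat 1) (transpose X) 0 (mat 1)"
    by (simp add: transpose_block_matrix transpose_mat) (simp add: transpose_def vec_eq_iff zero_vec_def)
  then show ?thesis by (metis det_transpose det_upper_shear)
qed

lemma matrix_mult_uminus_right: "(A::'a::comm_ring_1^'n^'m) ** (- B) = - (A ** B)"
  by (simp add: matrix_matrix_mult_def vec_eq_iff sum_negf)

lemma matrix_mult_uminus_left: "(- A::'a::comm_ring_1^'n^'m) ** B = - (A ** B)"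
  by (simp add: matrix_matrix_mult_def vec_eq_iff sum_negf)

text \<open>
  The transfer matrix is a product of four shears: one carries \<open>P\<close>, and the other three multiply
  to the block rotation \<open>[0, -Q\<^sup>-\<^sup>1; Q, 0]\<close>. Hence the determinant is \<open>1\<close> whatever \<open>P\<close> is.
\<close>

lemma det_jacobi_block:
  fixes P Q :: "'a::comm_ring_1 ^ 'l ^ 'l"
  assumes "invertible Q"
  shows "det (block_matrix P (- matrix_inv Q) Q 0) = 1"
proof -
  note inv = invertible_matrix_inv[OF assms]
  let ?U = "\<lambda>X. block_matrix (mat 1) X 0 (mat 1) :: 'a ^ ('l + 'l) ^ ('l + 'l)"
  have "block_matrix P (- matrix_inv Q) Q 0
      = ?U (P ** matrix_inv Q) ** (?U (- matrix_inv Q) ** (block_matrix (mat 1) 0 Q (mat 1) ** ?U (- matrix_inv Q)))"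
    by (simp add: block_matrix_mult matrix_mult_uminus_right matrix_mult_uminus_left inv 
        flip: matrix_mul_assoc)
  then show ?thesis
    by (simp add: det_mul det_upper_shear det_lower_shear)
qed

section \<open>Orbits and cocycle iterates\<close>

lemma iter_int_0 [simp]: "iter_int \<Omega> T 0 \<omega> = \<omega>"
  by (simp add: iter_int_def)

lemma
  assumes "bij_betw T \<Omega> \<Omega>" "\<omega> \<in> \<Omega>"
  shows iter_int_mem: "iter_int \<Omega> T j \<omega> \<in> \<Omega>"
    and iter_int_add_1: "iter_int \<Omega> T (j + 1) \<omega> = T (iter_int \<Omega> T j \<omega>)"
proof -
  have T: "T x \<in> \<Omega>" and S: "inv_into \<Omega> T x \<in> \<Omega>" and TS: "T (inv_into \<Omega> T x) = x" if "x \<in> \<Omega>" for x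
    using that assms(1) by (auto simp: bij_betw_def inv_into_into f_inv_into_f)
  have fwd: "(T ^^ m) \<omega> \<in> \<Omega>" and bwd: "(inv_into \<Omega> T ^^ m) \<omega> \<in> \<Omega>" for m
    using assms(2) by (induction m) (auto intro: T S)
  then show "iter_int \<Omega> T j \<omega> \<in> \<Omega>" by (simp add: iter_int_def)
  show "iter_int \<Omega> T (j + 1) \<omega> = T (iter_int \<Omega> T j \<omega>)"
  proof (cases "0 \<le> j")
    case True
    then show ?thesis by (simp add: iter_int_def nat_add_distrib)
  next
    case False
    define m where "m = nat (- j - 1)"
    have j: "j = - int (Suc m)" using False by (simp add: m_def)
    have "iter_int \<Omega> T (j + 1) \<omega> = (inv_into \<Omega> T ^^ m) \<omega>"
      by (cases m) (simp_all add: j iter_int_def nat_add_distrib)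
    moreover have "iter_int \<Omega> T j \<omega> = inv_into \<Omega> T ((inv_into \<Omega> T ^^ m) \<omega>)"
      by (simp add: j iter_int_def nat_add_distrib)
    ultimately show ?thesis using TS bwd by simp
  qed
qed

lemma iter_int_add:
  assumes T: "bij_betw T \<Omega> \<Omega>" and \<omega>: "\<omega> \<in> \<Omega>"
  shows "iter_int \<Omega> T (i + j) \<omega> = iter_int \<Omega> T i (iter_int \<Omega> T j \<omega>)"
proof (induction i rule: int_induct[where k = 0])
  case base
  show ?case by simp
next
  case (step1 i)
  then show ?case
    using iter_int_add_1[OF T \<omega>, of "i + j"] iter_int_add_1[OF T iter_int_mem[OF T \<omega>], of i j]
    by (simp add: algebra_simps)
next
  case (step2 i)
  let ?\<theta> = "iter_int \<Omega> T j \<omega>"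
  have \<theta>: "?\<theta> \<in> \<Omega>" by (rule iter_int_mem[OF T \<omega>])
  have "T (iter_int \<Omega> T (i - 1 + j) \<omega>) = T (iter_int \<Omega> T (i - 1) ?\<theta>)"
    using step2 iter_int_add_1[OF T \<omega>, of "i - 1 + j"] iter_int_add_1[OF T \<theta>, of "i - 1"]
    by (simp add: algebra_simps)
  then show ?case
    using T iter_int_mem[OF T \<omega>] iter_int_mem[OF T \<theta>] by (auto simp: bij_betw_def inj_on_def)
qed

lemma self_homeomorphism_bij_betw: "self_homeomorphism \<Omega> T \<Longrightarrow> bij_betw T \<Omega> \<Omega>"
  unfolding self_homeomorphism_def homeomorphism_def
  by (metis bij_betw_def inj_on_inverseI)

text \<open>
  The lower bound for the operator is carried from one orbit to its closure by continuity in the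
  base point; this is where continuity of all iterates, negative ones included, enters.
\<close>

lemma continuous_on_iter_int:
  assumes "self_homeomorphism \<Omega> T"
  shows "continuous_on \<Omega> (iter_int \<Omega> T j)"
proof (induction j rule: int_induct[where k = 0])
  case base
  show ?case by (simp add: iter_int_def[abs_def])
next
  note T = self_homeomorphism_bij_betw[OF assms]
  obtain S where hom: "homeomorphism \<Omega> \<Omega> T S"
    using assms unfolding self_homeomorphism_def by blast
  {
    case (step1 i)
    have "continuous_on \<Omega> (\<lambda>\<omega>. T (iter_int \<Omega> T i \<omega>))"
      by (rule continuous_on_compose2[OF homeomorphism_cont1[OF hom] step1(2)])
        (auto intro: iter_int_mem[OF T])
    then show ?case
      by (rule continuous_on_eq) (simp add: iter_int_add_1[OF T])
  next
    case (step2 i)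
    have "continuous_on \<Omega> (\<lambda>\<omega>. S (iter_int \<Omega> T i \<omega>))"
      by (rule continuous_on_compose2[OF homeomorphism_cont2[OF hom] step2(2)])
        (auto intro: iter_int_mem[OF T])
    then show ?case
    proof (rule continuous_on_eq)
      fix \<omega> assume \<omega>: "\<omega> \<in> \<Omega>"
      have "iter_int \<Omega> T i \<omega> = T (iter_int \<Omega> T (i - 1) \<omega>)"
        using iter_int_add_1[OF T \<omega>, of "i - 1"] by simp
      then show "S (iter_int \<Omega> T i \<omega>) = iter_int \<Omega> T (i - 1) \<omega>"
        using homeomorphism_apply1[OF hom] iter_int_mem[OF T \<omega>] by simp
    qed
  }
qed

lemma cocycle_iter_0 [simp]: "cocycle_iter \<Omega> T A 0 \<omega> = mat 1"
  by (simp add: cocycle_iter_def)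

text \<open>
  One recursion for all integers \<open>n\<close>: the orbit of a vector is a two-sided solution of a
  first-order system, with no case distinction between forward and backward iterates.
\<close>

lemma cocycle_iter_add_1:
  assumes "invertible (A (iter_int \<Omega> T n \<omega>))"
  shows "cocycle_iter \<Omega> T A (n + 1) \<omega> = A (iter_int \<Omega> T n \<omega>) ** cocycle_iter \<Omega> T A n \<omega>"
proof (cases "0 \<le> n")
  case True
  then show ?thesis by (simp add: cocycle_iter_def nat_add_distrib)
next
  case False
  define m where "m = nat (- n - 1)"
  have n: "n = - int (Suc m)" using False by (simp add: m_def)
  have "cocycle_iter \<Omega> T A (n + 1) \<omega> = cocycle_bwd \<Omega> T A m \<omega>"
    by (cases m) (simp_all add: n cocycle_iter_def nat_add_distrib)
  moreover have "cocycle_iter \<Omega> T A n \<omega>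
      = matrix_inv (A (iter_int \<Omega> T n \<omega>)) ** cocycle_bwd \<Omega> T A m \<omega>"
    by (simp add: n cocycle_iter_def nat_add_distrib)
  ultimately show ?thesis
    by (simp add: matrix_mul_assoc invertible_matrix_inv[OF assms])
qed

section \<open>A lower bound valid on the whole base space\<close>

lemma ell2_finite_support:
  assumes "finite S" "\<And>n. n \<notin> S \<Longrightarrow> u n = 0"
  shows "u \<in> ell2" "ell2_norm u = sqrt (\<Sum>n\<in>S. (norm (u n))\<^sup>2)"
proof -
  have "(\<lambda>n. (norm (u n))\<^sup>2) summable_on UNIV \<longleftrightarrow> (\<lambda>n. (norm (u n))\<^sup>2) summable_on S"
    by (rule summable_on_cong_neutral) (use assms in auto)
  then show "u \<in> ell2" using assms(1) by (simp add: ell2_def)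
  have "(\<Sum>\<^sub>\<infinity>n. (norm (u n))\<^sup>2) = (\<Sum>\<^sub>\<infinity>n\<in>S. (norm (u n))\<^sup>2)"
    by (rule infsum_cong_neutral) (use assms in auto)
  then show "ell2_norm u = sqrt (\<Sum>n\<in>S. (norm (u n))\<^sup>2)"
    using assms(1) by (simp add: ell2_norm_def)
qed

text \<open>
  Finitely supported sequences suffice as test functions, and for them the square-summable norms
  are finite sums. In this form the bound can be compared between different operators: only
  finitely many entries of the operator are involved.
\<close>

lemma resolvent_bounded_below:
  assumes "z \<in> resolvent_set H"
  shows "\<exists>C>0. \<forall>\<phi> S S'. finite S \<longrightarrow> finite S' \<longrightarrow> (\<forall>n. n \<notin> S \<longrightarrow> \<phi> n = 0) \<longrightarrow>
       (\<forall>n. n \<notin> S' \<longrightarrow> z *s \<phi> n - H \<phi> n = 0) \<longrightarrow>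
       (\<Sum>n\<in>S. (norm (\<phi> n))\<^sup>2) \<le> C * (\<Sum>n\<in>S'. (norm (z *s \<phi> n - H \<phi> n))\<^sup>2)"
proof -
  define B where "B = (\<lambda>u n. z *s u n - H u n)"
  have bij: "bij_betw B ell2 ell2" and op: "ell2_bounded_op (inv_into ell2 B)"
    using assms by (auto simp: resolvent_set_def B_def Let_def)
  obtain C where C: "\<And>u. u \<in> ell2 \<Longrightarrow> ell2_norm (inv_into ell2 B u) \<le> C * ell2_norm u"
    using op unfolding ell2_bounded_op_def by blast
  \<comment> \<open>Nothing is known about the sign of \<open>C\<close>; squaring \<open>\<bar>C\<bar> + 1\<close> gives a positive constant for the squared norms.\<close>
  show ?thesis
  proof (intro exI[of _ "(\<bar>C\<bar> + 1)\<^sup>2"] conjI allI impI)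
    show "0 < (\<bar>C\<bar> + 1)\<^sup>2" by (simp add: add_nonneg_pos)
    fix \<phi> S S'
    assume fin: "finite S" "finite S'" and supp: "\<forall>n. n \<notin> S \<longrightarrow> \<phi> n = 0"
      and supp': "\<forall>n. n \<notin> S' \<longrightarrow> z *s \<phi> n - H \<phi> n = 0"
    have S: "\<phi> n = 0" if "n \<notin> S" for n using supp that by blast
    have S': "B \<phi> n = 0" if "n \<notin> S'" for n using supp' that by (simp add: B_def)
    let ?X = "\<Sum>n\<in>S. (norm (\<phi> n))\<^sup>2" and ?Y = "\<Sum>n\<in>S'. (norm (B \<phi> n))\<^sup>2"
    have \<phi>: "\<phi> \<in> ell2" by (rule ell2_finite_support(1)[OF fin(1) S])
    have "ell2_norm \<phi> \<le> C * ell2_norm (B \<phi>)"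
      using C[of "B \<phi>"] \<phi> bij by (simp add: bij_betw_inv_into_left bij_betw_apply)
    moreover have "ell2_norm \<phi> = sqrt ?X" by (rule ell2_finite_support(2)[OF fin(1) S])
    moreover have "ell2_norm (B \<phi>) = sqrt ?Y" by (rule ell2_finite_support(2)[OF fin(2) S'])
    ultimately have "sqrt ?X \<le> C * sqrt ?Y" by simp
    also have "\<dots> \<le> (\<bar>C\<bar> + 1) * sqrt ?Y"
      by (intro mult_right_mono) (auto intro: sum_nonneg)
    also have "\<dots> = sqrt ((\<bar>C\<bar> + 1)\<^sup>2 * ?Y)" by (simp add: real_sqrt_mult)
    finally have "?X \<le> (\<bar>C\<bar> + 1)\<^sup>2 * ?Y" by simp
    then show "?X \<le> (\<bar>C\<bar> + 1)\<^sup>2 * (\<Sum>n\<in>S'. (norm (z *s \<phi> n - H \<phi> n))\<^sup>2)"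
      by (simp add: B_def)
  qed
qed

lemma jacobi_op_shift:
  assumes "bij_betw T \<Omega> \<Omega>" "\<omega> \<in> \<Omega>"
  shows "jacobi_op \<Omega> T D V (iter_int \<Omega> T j \<omega>) \<phi> n = jacobi_op \<Omega> T D V \<omega> (\<lambda>k. \<phi> (k - j)) (n + j)"
  unfolding jacobi_op_def by (simp add: iter_int_add[OF assms, symmetric] algebra_simps)

lemma jacobi_op_support:
  assumes "\<And>n. n \<notin> {a..b} \<Longrightarrow> \<phi> n = 0" "n \<notin> {a-1..b+1}"
  shows "jacobi_op \<Omega> T D V \<theta> \<phi> n = 0"
proof -
  have "\<phi> (n - 1) = 0" "\<phi> n = 0" "\<phi> (n + 1) = 0"
    by (rule assms(1); use assms(2) in auto)+
  then show ?thesis by (simp add: jacobi_op_def)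
qed

lemma continuous_on_jacobi_op:
  fixes D V :: "'w::topological_space \<Rightarrow> real ^ 'l ^ 'l"
  assumes T: "self_homeomorphism \<Omega> T" and D: "continuous_on \<Omega> D" and V: "continuous_on \<Omega> V"
  shows "continuous_on \<Omega> (\<lambda>\<theta>. jacobi_op \<Omega> T D V \<theta> \<phi> n)"
proof -
  have summand: "continuous_on \<Omega> (\<lambda>\<theta>. complex_matrix (F (iter_int \<Omega> T k \<theta>)) *v x)"
    if "continuous_on \<Omega> F" for F :: "'w \<Rightarrow> real ^ 'l ^ 'l" and k x
    by (intro continuous_on_matrix_vector_mult continuous_on_complex_matrix
        continuous_on_compose2[OF that continuous_on_iter_int[OF T]])
      (auto intro: iter_int_mem[OF self_homeomorphism_bij_betw[OF T]])
  show ?thesis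
    unfolding jacobi_op_def by (intro continuous_on_add summand D V)
qed

text \<open>
  Moving the base point along its orbit conjugates the operator by a shift, so the constant found
  at \<open>\<omega>\<close> serves for the whole orbit of \<open>\<omega>\<close>. For a fixed test function both sides of the inequality
  depend continuously on the base point, and by minimality the orbit is dense: the same constant
  serves everywhere.
\<close>

lemma jacobi_bounded_below_uniformly:
  fixes \<Omega> :: "'w::metric_space set"
    and D V :: "'w \<Rightarrow> real ^ 'l ^ 'l"
  assumes "compact \<Omega>" and min: "minimal_homeomorphism \<Omega> T"
    and cont: "continuous_on \<Omega> D" "continuous_on \<Omega> V"
    and \<omega>: "\<omega> \<in> \<Omega>" and z: "z \<in> resolvent_set (jacobi_op \<Omega> T D V \<omega>)"
  shows "\<exists>C>0. \<forall>\<theta>\<in>\<Omega>. \<forall>\<phi> a b. (\<forall>n. n \<notin> {a..b} \<longrightarrow> \<phi> n = 0) \<longrightarrow>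
       (\<Sum>n=a..b. (norm (\<phi> n))\<^sup>2) \<le> C * (\<Sum>n=a-1..b+1. (norm (z *s \<phi> n - jacobi_op \<Omega> T D V \<theta> \<phi> n))\<^sup>2)"
proof -
  have T: "self_homeomorphism \<Omega> T" using min by (simp add: minimal_homeomorphism_def)
  note bij = self_homeomorphism_bij_betw[OF T]
  let ?H = "jacobi_op \<Omega> T D V"
  obtain C where C: "0 < C"
    and bd: "\<forall>\<phi> S S'. finite S \<longrightarrow> finite S' \<longrightarrow> (\<forall>n. n \<notin> S \<longrightarrow> \<phi> n = 0) \<longrightarrow>
       (\<forall>n. n \<notin> S' \<longrightarrow> z *s \<phi> n - ?H \<omega> \<phi> n = 0) \<longrightarrow>
       (\<Sum>n\<in>S. (norm (\<phi> n))\<^sup>2) \<le> C * (\<Sum>n\<in>S'. (norm (z *s \<phi> n - ?H \<omega> \<phi> n))\<^sup>2)"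
    using resolvent_bounded_below[OF z] by blast
  show ?thesis
  proof (intro exI[of _ C] conjI C ballI allI impI)
    fix \<theta> and \<phi> :: "int \<Rightarrow> complex ^ 'l" and a b :: int
    assume \<theta>: "\<theta> \<in> \<Omega>" and supp: "\<forall>n. n \<notin> {a..b} \<longrightarrow> \<phi> n = 0"
    define F where "F = (\<lambda>\<theta>. C * (\<Sum>n=a-1..b+1. (norm (z *s \<phi> n - ?H \<theta> \<phi> n))\<^sup>2))"
    let ?orbit = "range (\<lambda>j. iter_int \<Omega> T j \<omega>)"
    have orbit: "(\<Sum>n=a..b. (norm (\<phi> n))\<^sup>2) \<le> F (iter_int \<Omega> T j \<omega>)" for j
    proof -
      define \<psi> where "\<psi> = (\<lambda>k. \<phi> (k - j))"
      have supp\<psi>: "\<psi> n = 0" if "n \<notin> {a+j..b+j}" for n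
        unfolding \<psi>_def by (rule supp[rule_format]) (use that in auto)
      have shift: "(\<Sum>n=c+j..d+j. f n) = (\<Sum>n=c..d. f (n + j))" for c d and f :: "int \<Rightarrow> real"
        by (rule sum.reindex_bij_witness[of _ "\<lambda>n. n + j" "\<lambda>n. n - j"]) auto
      have "(\<Sum>n=a+j..b+j. (norm (\<psi> n))\<^sup>2)
          \<le> C * (\<Sum>n=a-1+j..b+1+j. (norm (z *s \<psi> n - ?H \<omega> \<psi> n))\<^sup>2)"
      proof (rule bd[rule_format])
        show "z *s \<psi> n - ?H \<omega> \<psi> n = 0" if "n \<notin> {a-1+j..b+1+j}" for n
          using that by (subst jacobi_op_support[OF supp\<psi>]) (auto intro: supp\<psi>)
      qed (auto intro: supp\<psi>)
      then show ?thesis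
        unfolding shift F_def by (simp add: \<psi>_def jacobi_op_shift[OF bij \<omega>])
    qed
    have closure: "closure ?orbit = \<Omega>"
    proof
      show "closure ?orbit \<subseteq> \<Omega>"
        using \<open>compact \<Omega>\<close> iter_int_mem[OF bij \<omega>] by (intro closure_minimal compact_imp_closed) auto
      show "\<Omega> \<subseteq> closure ?orbit" using min \<omega> by (auto simp: minimal_homeomorphism_def)
    qed
    have contF: "continuous_on \<Omega> F"
      unfolding F_def by (intro continuous_intros continuous_on_jacobi_op T cont)
    have "(\<Sum>n=a..b. (norm (\<phi> n))\<^sup>2) \<le> F \<theta>"
    proof (rule continuous_ge_on_closure[of ?orbit])
      show "continuous_on (closure ?orbit) F" "\<theta> \<in> closure ?orbit"
        using contF \<theta> unfolding closure .
      show "(\<Sum>n=a..b. (norm (\<phi> n))\<^sup>2) \<le> F x" if "x \<in> ?orbit" for x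
        using that orbit by blast
    qed
    then show "(\<Sum>n=a..b. (norm (\<phi> n))\<^sup>2) \<le> C * (\<Sum>n=a-1..b+1. (norm (z *s \<phi> n - ?H \<theta> \<phi> n))\<^sup>2)"
      by (simp add: F_def)
  qed
qed

section \<open>The Jacobi cocycle and solutions of the eigenvalue equation\<close>

definition upper_half :: "'a ^ ('l::finite + 'l) \<Rightarrow> 'a ^ 'l" where
  "upper_half W = (\<chi> a. W $ Inl a)"

definition lower_half :: "'a ^ ('l::finite + 'l) \<Rightarrow> 'a ^ 'l" where
  "lower_half W = (\<chi> a. W $ Inr a)"

lemma norm_halves_sq:
  fixes W :: "complex ^ ('l::finite + 'l)"
  shows "(norm W)\<^sup>2 = (norm (upper_half W))\<^sup>2 + (norm (lower_half W))\<^sup>2"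
  by (simp add: norm_vec_def L2_set_def sum_nonneg sum_UNIV_Plus upper_half_def lower_half_def)

lemma block_matrix_vector_mult:
  fixes P Q R S :: "'a::semiring_1 ^ 'l ^ 'l"
  shows "upper_half (block_matrix P Q R S *v W) = P *v upper_half W + Q *v lower_half W"
    and "lower_half (block_matrix P Q R S *v W) = R *v upper_half W + S *v lower_half W"
  by (simp_all add: vec_eq_iff matrix_vector_mult_def sum_UNIV_Plus upper_half_def lower_half_def)

lemma continuous_on_block_matrix:
  fixes P Q R S :: "'w::topological_space \<Rightarrow> complex ^ 'l ^ 'l"
  assumes "continuous_on X P" "continuous_on X Q" "continuous_on X R" "continuous_on X S"
  shows "continuous_on X (\<lambda>w. block_matrix (P w) (Q w) (R w) (S w))"
proof -
  have "continuous_on X (\<lambda>w. block_matrix (P w) (Q w) (R w) (S w) $ i $ j)" for i j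
    by (cases i; cases j) (auto intro!: continuous_intros assms)
  then have "continuous_on X (\<lambda>w. \<chi> i. \<chi> j. block_matrix (P w) (Q w) (R w) (S w) $ i $ j)"
    by (intro continuous_on_vec_lambda)
  then show ?thesis by (simp only: vec_nth_inverse)
qed

lemma jacobi_cocycle_SL:
  fixes D V :: "'w::topological_space \<Rightarrow> real ^ 'l ^ 'l"
  assumes T: "self_homeomorphism \<Omega> T" and D: "continuous_on \<Omega> D" and V: "continuous_on \<Omega> V"
    and inv: "\<And>\<omega>. \<omega> \<in> \<Omega> \<Longrightarrow> invertible (D \<omega>)"
  shows "SL_cocycle \<Omega> T (jacobi_cocycle T D V z)"
proof -
  have mem: "T \<omega> \<in> \<Omega>" if "\<omega> \<in> \<Omega>" for \<omega>
    using self_homeomorphism_bij_betw[OF T] that by (rule bij_betw_apply)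
  have contT: "continuous_on \<Omega> T"
    using T unfolding self_homeomorphism_def homeomorphism_def by blast
  have comp: "continuous_on \<Omega> (\<lambda>\<omega>. complex_matrix (F (T \<omega>)))"
    if "continuous_on \<Omega> F" for F :: "'w \<Rightarrow> real ^ 'l ^ 'l"
    by (intro continuous_on_complex_matrix continuous_on_compose2[OF that contT]) (auto intro: mem)
  have invD: "continuous_on \<Omega> (\<lambda>\<omega>. matrix_inv (complex_matrix (D (T \<omega>))))"
    by (intro continuous_on_matrix_inv comp D invertible_complex_matrix inv mem)
  have "continuous_on \<Omega> (jacobi_cocycle T D V z)"
    unfolding jacobi_cocycle_def[abs_def]
    by (intro continuous_on_block_matrix continuous_on_matrix_mult continuous_intros comp invD D V)
  moreover have "det (jacobi_cocycle T D V z \<omega>) = 1" if "\<omega> \<in> \<Omega>" for \<omega>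
    unfolding jacobi_cocycle_def
    by (intro det_jacobi_block invertible_complex_matrix inv mem that)
  ultimately show ?thesis using T by (simp add: SL_cocycle_def)
qed

text \<open>
  Both the cocycle and its inverse are continuous on a compact set, hence bounded. One step
  therefore changes the length of a vector at most by a fixed factor, in either direction.
\<close>

lemma SL_cocycle_orbit_slowly_varying:
  fixes A :: "'w::topological_space \<Rightarrow> complex ^ 'n ^ 'n"
  assumes "compact \<Omega>" and A: "SL_cocycle \<Omega> T A"
  shows "\<exists>M\<ge>1. \<forall>\<theta>\<in>\<Omega>. \<forall>n v.
       norm (cocycle_iter \<Omega> T A (n + 1) \<theta> *v v) \<le> M * norm (cocycle_iter \<Omega> T A n \<theta> *v v) \<and>
       norm (cocycle_iter \<Omega> T A n \<theta> *v v) \<le> M * norm (cocycle_iter \<Omega> T A (n + 1) \<theta> *v v)"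
proof -
  have T: "self_homeomorphism \<Omega> T" and cont: "continuous_on \<Omega> A"
    and inv: "\<And>\<omega>. \<omega> \<in> \<Omega> \<Longrightarrow> invertible (A \<omega>)"
    using A by (auto simp: SL_cocycle_def invertible_det_nz)
  obtain K where K: "1 \<le> K" "\<And>\<omega> x. \<omega> \<in> \<Omega> \<Longrightarrow> norm (A \<omega> *v x) \<le> K * norm x"
    using compact_uniform_matrix_bound[OF \<open>compact \<Omega>\<close> cont] by blast
  obtain L where L: "1 \<le> L" "\<And>\<omega> x. \<omega> \<in> \<Omega> \<Longrightarrow> norm (matrix_inv (A \<omega>) *v x) \<le> L * norm x"
    using compact_uniform_matrix_bound[OF \<open>compact \<Omega>\<close> continuous_on_matrix_inv[OF cont inv]] by blast
  have le_max: "K * norm x \<le> max K L * norm x" "L * norm x \<le> max K L * norm x" for x :: "complex ^ 'n"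
    by (auto intro: mult_right_mono)
  show ?thesis
  proof (intro exI[of _ "max K L"] conjI[of "1 \<le> max K L"] ballI allI)
    fix \<theta> n and v :: "complex ^ 'n"
    assume "\<theta> \<in> \<Omega>"
    then have mem: "iter_int \<Omega> T n \<theta> \<in> \<Omega>"
      by (rule iter_int_mem[OF self_homeomorphism_bij_betw[OF T]])
    let ?W = "\<lambda>n. cocycle_iter \<Omega> T A n \<theta> *v v" and ?A = "A (iter_int \<Omega> T n \<theta>)"
    have next_W: "?W (n + 1) = ?A *v ?W n"
      by (simp add: cocycle_iter_add_1[of A \<Omega> T n \<theta>, OF inv[OF mem]] matrix_vector_mul_assoc)
    then have prev_W: "?W n = matrix_inv ?A *v ?W (n + 1)"
      by (simp add: matrix_vector_mul_assoc matrix_mul_assoc invertible_matrix_inv[OF inv[OF mem]])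
    have "norm (?W (n + 1)) \<le> K * norm (?W n)"
      unfolding next_W by (rule K(2)[OF mem])
    moreover have "norm (?W n) \<le> L * norm (?W (n + 1))"
      by (subst prev_W) (rule L(2)[OF mem])
    ultimately show "norm (?W (n + 1)) \<le> max K L * norm (?W n) \<and>
        norm (?W n) \<le> max K L * norm (?W (n + 1))"
      using le_max by (blast intro: order.trans)
  qed (use K in auto)
qed

lemma mat_vector_mult: "mat z *v x = z *s (x :: 'a::comm_semiring_1 ^ 'n)"
  by (simp add: vec_eq_iff matrix_vector_mult_def mat_def if_distrib if_distribR cong: if_cong)

text \<open>
  Orbits of the cocycle are solutions of the eigenvalue equation in disguise:
  \<open>W n\<close> is the pair \<open>(u (n+1), D\<^sub>n u n)\<close>, where \<open>u\<close> solves the three-term recursion. The upper half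
  of the cocycle equation is that recursion solved for its last term.
\<close>

lemma jacobi_cocycle_solution:
  fixes D V :: "'w \<Rightarrow> real ^ 'l ^ 'l"
  assumes T: "bij_betw T \<Omega> \<Omega>" and inv: "\<And>\<omega>. \<omega> \<in> \<Omega> \<Longrightarrow> invertible (D \<omega>)" and \<theta>: "\<theta> \<in> \<Omega>"
    and W: "\<And>n. W (n + 1) = jacobi_cocycle T D V z (iter_int \<Omega> T n \<theta>) *v W n"
  defines "u \<equiv> \<lambda>n. upper_half (W (n - 1))"
  shows "lower_half (W n) = complex_matrix (D (iter_int \<Omega> T n \<theta>)) *v u n"
    and "jacobi_op \<Omega> T D V \<theta> u n = z *s u n"
proof -
  define E where "E n = complex_matrix (D (iter_int \<Omega> T n \<theta>))" for n
  define U where "U n = complex_matrix (V (iter_int \<Omega> T n \<theta>))" for n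
  have invE: "invertible (E n)" for n
    unfolding E_def by (intro invertible_complex_matrix inv iter_int_mem[OF T \<theta>])
  have A: "jacobi_cocycle T D V z (iter_int \<Omega> T n \<theta>) =
      block_matrix (matrix_inv (E (n+1)) ** (mat z - U (n+1))) (- matrix_inv (E (n+1))) (E (n+1)) 0" for n
    unfolding jacobi_cocycle_def E_def U_def by (simp add: iter_int_add_1[OF T \<theta>])
  have low: "lower_half (W (n + 1)) = E (n + 1) *v upper_half (W n)" for n
    unfolding W A block_matrix_vector_mult by simp
  have l: "lower_half (W n) = E n *v u n" for n
    using low[of "n - 1"] by (simp add: u_def)
  have "E (n + 1) *v upper_half (W (n + 1))
      = (mat z - U (n + 1)) *v upper_half (W n) - lower_half (W n)" for n
  proof -
    have "upper_half (W (n + 1))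
        = matrix_inv (E (n + 1)) *v ((mat z - U (n + 1)) *v upper_half (W n) - lower_half (W n))"
      unfolding W A block_matrix_vector_mult
      by (simp add: matrix_vector_mul_assoc[symmetric] matrix_vector_mult_diff_distrib)
        (simp add: matrix_vector_mult_def vec_eq_iff sum_negf)
    then show ?thesis
      by (simp add: matrix_vector_mul_assoc matrix_mul_assoc invertible_matrix_inv[OF invE])
  qed
  from this[of "n - 1"] have "E n *v u (n + 1) = (mat z - U n) *v u n - E (n - 1) *v u (n - 1)"
    using l[of "n - 1"] by (simp add: u_def)
  then show "jacobi_op \<Omega> T D V \<theta> u n = z *s u n"
    unfolding jacobi_op_def E_def[symmetric] U_def[symmetric]
    by (simp add: matrix_vector_mult_diff_rdistrib mat_vector_mult)
  show "lower_half (W n) = complex_matrix (D (iter_int \<Omega> T n \<theta>)) *v u n"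
    using l unfolding E_def .
qed

text \<open>
  A solution cut off to \<open>{a+1..b}\<close> fails the eigenvalue equation only at \<open>a\<close>, \<open>a+1\<close>, \<open>b\<close> and \<open>b+1\<close>,
  and the errors there are entries of \<open>W a\<close> and \<open>W b\<close>, some multiplied by a value of \<open>D\<close>. The lower
  bound for the operator therefore controls the solution inside the window by \<open>W\<close> at its two ends.
\<close>

lemma truncated_solution_estimate:
  fixes D V :: "'w \<Rightarrow> real ^ 'l ^ 'l"
  assumes T: "bij_betw T \<Omega> \<Omega>" and inv: "\<And>\<omega>. \<omega> \<in> \<Omega> \<Longrightarrow> invertible (D \<omega>)" and \<theta>: "\<theta> \<in> \<Omega>"
    and W: "\<And>n. W (n + 1) = jacobi_cocycle T D V z (iter_int \<Omega> T n \<theta>) *v W n"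
    and C: "0 < C" "\<forall>\<phi> a b. (\<forall>n. n \<notin> {a..b} \<longrightarrow> \<phi> n = 0) \<longrightarrow>
       (\<Sum>n=a..b. (norm (\<phi> n))\<^sup>2) \<le> C * (\<Sum>n=a-1..b+1. (norm (z *s \<phi> n - jacobi_op \<Omega> T D V \<theta> \<phi> n))\<^sup>2)"
    and K: "1 \<le> K" "\<And>\<omega> x. \<omega> \<in> \<Omega> \<Longrightarrow> norm (complex_matrix (D \<omega>) *v x) \<le> K * norm x"
    and "a \<le> b"
  shows "(\<Sum>n=a..b. (norm (W n))\<^sup>2) \<le> (2 + 2 * C * K ^ 4) * ((norm (W a))\<^sup>2 + (norm (W b))\<^sup>2)"
proof -
  define u where "u n = upper_half (W (n - 1))" for n
  define E where "E n = complex_matrix (D (iter_int \<Omega> T n \<theta>))" for n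
  have l: "lower_half (W n) = E n *v u n" for n
    unfolding E_def u_def by (rule jacobi_cocycle_solution(1)[OF T inv \<theta> W])
  have sol: "jacobi_op \<Omega> T D V \<theta> u n = z *s u n" for n
    unfolding u_def by (rule jacobi_cocycle_solution(2)[OF T inv \<theta> W])
  have up: "upper_half (W n) = u (n + 1)" for n by (simp add: u_def)
  have W2: "(norm (W n))\<^sup>2 = (norm (u (n + 1)))\<^sup>2 + (norm (E n *v u n))\<^sup>2" for n
    by (simp add: norm_halves_sq l up)
  have K2: "1 \<le> K\<^sup>2" using K(1) by (simp add: one_le_power)
  have E2: "(norm (E n *v x))\<^sup>2 \<le> K\<^sup>2 * (norm x)\<^sup>2" for n x
    using power_mono[OF K(2)[OF iter_int_mem[OF T \<theta>]], of n x 2] by (simp add: E_def power_mult_distrib)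
  \<comment> \<open>Windows of at most two points are trivial, and the four error sites coincide in part there. For
    \<open>b = a\<close> the single term is counted at both ends.\<close>
  consider "b = a" | "b = a + 1" | "a + 1 < b" using \<open>a \<le> b\<close> by linarith
  then show ?thesis
  proof cases
    case 1
    then show ?thesis using C K by (simp add: algebra_simps)
  next
    case 2
    have "{a..b} = {a, b}" using 2 by auto
    then have "(\<Sum>n=a..b. (norm (W n))\<^sup>2) = 1 * ((norm (W a))\<^sup>2 + (norm (W b))\<^sup>2)" using 2 by simp
    also have "\<dots> \<le> (2 + 2 * C * K ^ 4) * ((norm (W a))\<^sup>2 + (norm (W b))\<^sup>2)"
      using C K by (intro mult_right_mono) auto
    finally show ?thesis .
  next
    case 3
    define \<phi> where "\<phi> n = (if n \<in> {a+1..b} then u n else 0)" for n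
    define g where "g n = z *s \<phi> n - jacobi_op \<Omega> T D V \<theta> \<phi> n" for n
    note jacobi_at = jacobi_op_def[of \<Omega> T D V \<theta>, folded E_def]
    have g0: "g n = 0" if "n \<notin> {a, a+1, b, b+1}" for n
    proof (cases "n \<in> {a+2..b-1}")
      case True
      then have "jacobi_op \<Omega> T D V \<theta> \<phi> n = jacobi_op \<Omega> T D V \<theta> u n"
        by (simp add: jacobi_at \<phi>_def)
      then show ?thesis using True by (simp add: g_def sol \<phi>_def)
    next
      case False
      then show ?thesis using that by (auto simp: g_def jacobi_at \<phi>_def)
    qed
    have ga: "g a = - (E a *v u (a + 1))"
      using 3 by (simp add: g_def jacobi_at \<phi>_def)
    have ga1: "g (a + 1) = E a *v u a"
      using 3 sol[of "a + 1"] by (simp add: g_def jacobi_at \<phi>_def algebra_simps)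
    have gb: "g b = E b *v u (b + 1)"
      using 3 sol[of b] by (simp add: g_def jacobi_at \<phi>_def algebra_simps)
    have gb1: "g (b + 1) = - (E b *v u b)"
      using 3 by (simp add: g_def jacobi_at \<phi>_def)
    have "(\<Sum>n=a..b+1. (norm (g n))\<^sup>2) = (\<Sum>n\<in>{a, a+1, b, b+1}. (norm (g n))\<^sup>2)"
      by (rule sum.mono_neutral_right) (use g0 3 in auto)
    also have "\<dots> = (norm (E a *v u (a + 1)))\<^sup>2 + (norm (E a *v u a))\<^sup>2
        + (norm (E b *v u (b + 1)))\<^sup>2 + (norm (E b *v u b))\<^sup>2"
      using 3 by (simp add: ga ga1 gb gb1)
    also have "\<dots> \<le> K\<^sup>2 * ((norm (W a))\<^sup>2 + (norm (W b))\<^sup>2)"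
    proof -
      have "(norm (E n *v u (n + 1)))\<^sup>2 + (norm (E n *v u n))\<^sup>2 \<le> K\<^sup>2 * (norm (W n))\<^sup>2" for n
        using E2[of n "u (n + 1)"] mult_right_mono[OF K2, of "(norm (E n *v u n))\<^sup>2"]
        by (simp add: W2 distrib_left)
      from this[of a] this[of b] show ?thesis by (simp add: distrib_left)
    qed
    finally have resid: "(\<Sum>n=a..b+1. (norm (g n))\<^sup>2) \<le> K\<^sup>2 * ((norm (W a))\<^sup>2 + (norm (W b))\<^sup>2)" .
    let ?S = "\<Sum>n=a+1..b. (norm (u n))\<^sup>2"
    have "(\<Sum>n=a+1..b. (norm (\<phi> n))\<^sup>2) \<le> C * (\<Sum>n=a+1-1..b+1. (norm (g n))\<^sup>2)"
      unfolding g_def by (rule C(2)[rule_format]) (auto simp: \<phi>_def)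
    moreover have "(\<Sum>n=a+1..b. (norm (\<phi> n))\<^sup>2) = ?S"
      by (rule sum.cong) (auto simp: \<phi>_def)
    ultimately have "?S \<le> C * (\<Sum>n=a..b+1. (norm (g n))\<^sup>2)" by simp
    also have "\<dots> \<le> C * (K\<^sup>2 * ((norm (W a))\<^sup>2 + (norm (W b))\<^sup>2))"
      using resid C(1) by simp
    finally have S: "?S \<le> C * (K\<^sup>2 * ((norm (W a))\<^sup>2 + (norm (W b))\<^sup>2))" .
    \<comment> \<open>Recovering \<open>W\<close> from \<open>u\<close> costs a second factor \<open>K\<^sup>2\<close>, whence \<open>K ^ 4\<close> in the bound.\<close>
    have "(\<Sum>n=a+1..b-1. (norm (W n))\<^sup>2) \<le> (\<Sum>n=a+1..b-1. (norm (u (n + 1)))\<^sup>2) + K\<^sup>2 * (\<Sum>n=a+1..b-1. (norm (u n))\<^sup>2)"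
      unfolding W2 sum.distrib sum_distrib_left by (intro add_left_mono sum_mono E2)
    also have "\<dots> \<le> ?S + K\<^sup>2 * ?S"
    proof (rule add_mono)
      have "(\<Sum>n=a+1..b-1. (norm (u (n + 1)))\<^sup>2) = (\<Sum>n=a+2..b. (norm (u n))\<^sup>2)"
        by (rule sum.reindex_bij_witness[of _ "\<lambda>n. n - 1" "\<lambda>n. n + 1"]) auto
      also have "\<dots> \<le> ?S" by (rule sum_mono2) auto
      finally show "(\<Sum>n=a+1..b-1. (norm (u (n + 1)))\<^sup>2) \<le> ?S" .
      show "K\<^sup>2 * (\<Sum>n=a+1..b-1. (norm (u n))\<^sup>2) \<le> K\<^sup>2 * ?S"
        by (intro mult_left_mono sum_mono2) auto
    qed
    also have "\<dots> \<le> 2 * K\<^sup>2 * ?S"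
      using mult_right_mono[OF K2, of ?S] by (simp add: sum_nonneg)
    also have "\<dots> \<le> 2 * K\<^sup>2 * (C * (K\<^sup>2 * ((norm (W a))\<^sup>2 + (norm (W b))\<^sup>2)))"
      by (intro mult_left_mono S) simp
    also have "\<dots> = 2 * C * K ^ 4 * ((norm (W a))\<^sup>2 + (norm (W b))\<^sup>2)"
      by (simp add: power2_eq_square power4_eq_xxxx)
    finally have mid: "(\<Sum>n=a+1..b-1. (norm (W n))\<^sup>2)
        \<le> 2 * C * K ^ 4 * ((norm (W a))\<^sup>2 + (norm (W b))\<^sup>2)" .
    have "{a..b} = insert a (insert b {a+1..b-1})" using 3 by auto
    with 3 have "(\<Sum>n=a..b. (norm (W n))\<^sup>2)
        = (norm (W a))\<^sup>2 + (norm (W b))\<^sup>2 + (\<Sum>n=a+1..b-1. (norm (W n))\<^sup>2)"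
      by simp
    also have "\<dots> \<le> 2 * ((norm (W a))\<^sup>2 + (norm (W b))\<^sup>2) + 2 * C * K ^ 4 * ((norm (W a))\<^sup>2 + (norm (W b))\<^sup>2)"
      by (rule add_mono[OF _ mid]) simp
    also have "\<dots> = (2 + 2 * C * K ^ 4) * ((norm (W a))\<^sup>2 + (norm (W b))\<^sup>2)"
      by (rule distrib_right[symmetric])
    finally show ?thesis .
  qed
qed

section \<open>Resolvent points give uniform exponential growth\<close>

theorem theorem1p4:
  fixes \<Omega> :: "'w::metric_space set"
    and T :: "'w \<Rightarrow> 'w"
    and D V :: "'w \<Rightarrow> real ^ 'l ^ 'l"
  assumes "\<Omega> \<noteq> {}" and "compact \<Omega>"
    and "minimal_homeomorphism \<Omega> T"
    and "continuous_on \<Omega> D" and "continuous_on \<Omega> V"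
    and "\<And>\<omega>. \<omega> \<in> \<Omega> \<Longrightarrow> transpose (D \<omega>) = D \<omega>"
    and "\<And>\<omega>. \<omega> \<in> \<Omega> \<Longrightarrow> transpose (V \<omega>) = V \<omega>"
    and "\<And>\<omega>. \<omega> \<in> \<Omega> \<Longrightarrow> invertible (D \<omega>)"
  shows "\<forall>\<omega>\<in>\<Omega>. resolvent_set (jacobi_op \<Omega> T D V \<omega>)
                 \<subseteq> {z. (T, jacobi_cocycle T D V z) \<in> UG \<Omega>}"
proof (intro ballI subsetI CollectI)
  fix \<omega> z
  assume \<omega>: "\<omega> \<in> \<Omega>" and z: "z \<in> resolvent_set (jacobi_op \<Omega> T D V \<omega>)"
  note inv = assms(8)
  have T: "self_homeomorphism \<Omega> T" using assms(3) by (simp add: minimal_homeomorphism_def)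
  note bij = self_homeomorphism_bij_betw[OF T]
  let ?A = "jacobi_cocycle T D V z"
  have SL: "SL_cocycle \<Omega> T ?A" by (rule jacobi_cocycle_SL[OF T assms(4,5) inv])
  obtain C where C: "0 < C"
    and below: "\<forall>\<theta>\<in>\<Omega>. \<forall>\<phi> a b. (\<forall>n. n \<notin> {a..b} \<longrightarrow> \<phi> n = 0) \<longrightarrow>
       (\<Sum>n=a..b. (norm (\<phi> n))\<^sup>2) \<le> C * (\<Sum>n=a-1..b+1. (norm (z *s \<phi> n - jacobi_op \<Omega> T D V \<theta> \<phi> n))\<^sup>2)"
    using jacobi_bounded_below_uniformly[OF assms(2-5) \<omega> z] by blast
  obtain K where K: "1 \<le> K" "\<And>\<omega> x. \<omega> \<in> \<Omega> \<Longrightarrow> norm (complex_matrix (D \<omega>) *v x) \<le> K * norm x"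
    using compact_uniform_matrix_bound[OF assms(2) continuous_on_complex_matrix[OF assms(4)]] by blast
  obtain M where M: "1 \<le> M"
    and slow: "\<forall>\<theta>\<in>\<Omega>. \<forall>n v.
       norm (cocycle_iter \<Omega> T ?A (n + 1) \<theta> *v v) \<le> M * norm (cocycle_iter \<Omega> T ?A n \<theta> *v v) \<and>
       norm (cocycle_iter \<Omega> T ?A n \<theta> *v v) \<le> M * norm (cocycle_iter \<Omega> T ?A (n + 1) \<theta> *v v)"
    using SL_cocycle_orbit_slowly_varying[OF assms(2) SL] by blast
  define \<delta> where "\<delta> = 1 / (2 + 2 * C * K ^ 4)"
  have denom: "0 < 2 + 2 * C * K ^ 4" using C K(1) by (simp add: add_pos_nonneg)
  then have \<delta>: "0 < \<delta>" by (simp add: \<delta>_def)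
  obtain \<beta> r where \<beta>: "0 < \<beta>" and r: "1 < r"
    and dich: "\<forall>x :: int \<Rightarrow> real.
     (\<forall>n. 0 < x n \<and> x n \<le> M * x (n + 1) \<and> x (n + 1) \<le> M * x n) \<longrightarrow>
     (\<forall>a b. a \<le> b \<longrightarrow> \<delta> * (\<Sum>n=a..b. (x n)\<^sup>2) \<le> (x a)\<^sup>2 + (x b)\<^sup>2) \<longrightarrow>
     (\<forall>n. \<beta> * r ^ n * x 0 \<le> x (int n)) \<or> (\<forall>n. \<beta> * r ^ n * x 0 \<le> x (- int n))"
    using exponential_growth_dichotomy[OF \<delta> M] by blast
  have growth: "(\<forall>n::nat. \<beta> * r ^ n * norm v \<le> norm (cocycle_iter \<Omega> T ?A (int n) \<theta> *v v)) \<or>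
      (\<forall>n::nat. \<beta> * r ^ n * norm v \<le> norm (cocycle_iter \<Omega> T ?A (- int n) \<theta> *v v))"
    if \<theta>: "\<theta> \<in> \<Omega>" and v: "v \<noteq> 0" for \<theta> v
  proof -
    define W where "W n = cocycle_iter \<Omega> T ?A n \<theta> *v v" for n
    have W0: "W 0 = v" by (simp add: W_def)
    have W: "W (n + 1) = ?A (iter_int \<Omega> T n \<theta>) *v W n" for n
    proof -
      have "invertible (?A (iter_int \<Omega> T n \<theta>))"
        using SL iter_int_mem[OF bij \<theta>] by (auto simp: SL_cocycle_def invertible_det_nz)
      then show ?thesis by (simp add: W_def cocycle_iter_add_1 matrix_vector_mul_assoc)
    qed
    have up: "norm (W n) \<le> M * norm (W (n + 1))" and down: "norm (W (n + 1)) \<le> M * norm (W n)" for n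
      unfolding W_def using slow \<theta> by blast+
    have nz: "0 < norm (W n)" for n
    proof (induction n rule: int_induct[where k = 0])
      case base
      show ?case using v by (simp add: W0)
    next
      case (step1 i)
      then show ?case using up[of i] by (cases "W (i + 1) = 0") auto
    next
      case (step2 i)
      then show ?case using down[of "i - 1"] by (cases "W (i - 1) = 0") auto
    qed
    have "\<delta> * (\<Sum>n=a..b. (norm (W n))\<^sup>2) \<le> (norm (W a))\<^sup>2 + (norm (W b))\<^sup>2" if "a \<le> b" for a b
    proof -
      have "(\<Sum>n=a..b. (norm (W n))\<^sup>2) \<le> (2 + 2 * C * K ^ 4) * ((norm (W a))\<^sup>2 + (norm (W b))\<^sup>2)"
        by (rule truncated_solution_estimate[OF bij inv \<theta> W C bspec[OF below \<theta>] K that])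
      then show ?thesis using denom by (simp add: \<delta>_def divide_le_eq mult.commute)
    qed
    then have sums: "\<forall>a b. a \<le> b \<longrightarrow> \<delta> * (\<Sum>n=a..b. (norm (W n))\<^sup>2) \<le> (norm (W a))\<^sup>2 + (norm (W b))\<^sup>2"
      by blast
    have steps: "\<forall>n. 0 < norm (W n) \<and> norm (W n) \<le> M * norm (W (n + 1)) \<and> norm (W (n + 1)) \<le> M * norm (W n)"
      using nz up down by blast
    have "(\<forall>n. \<beta> * r ^ n * norm (W 0) \<le> norm (W (int n))) \<or>
        (\<forall>n. \<beta> * r ^ n * norm (W 0) \<le> norm (W (- int n)))"
      by (rule dich[THEN spec, of "\<lambda>n. norm (W n)", THEN mp, THEN mp, OF steps sums])
    then show ?thesis
      unfolding W0 unfolding W_def .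
  qed
  have "\<exists>\<beta>>0. \<exists>r>1. \<forall>\<theta>\<in>\<Omega>. \<forall>v. v \<noteq> 0 \<longrightarrow>
        (\<forall>n::nat. n \<ge> 1 \<longrightarrow> norm (cocycle_iter \<Omega> T ?A (int n) \<theta> *v v) \<ge> \<beta> * r ^ n * norm v) \<or>
        (\<forall>n::nat. n \<ge> 1 \<longrightarrow> norm (cocycle_iter \<Omega> T ?A (- int n) \<theta> *v v) \<ge> \<beta> * r ^ n * norm v)"
  proof (rule exI[of _ \<beta>], intro conjI \<beta>, rule exI[of _ r], intro conjI ballI allI impI r)
    fix \<theta> and v :: "complex ^ ('l + 'l)"
    assume "\<theta> \<in> \<Omega>" "v \<noteq> 0"
    from growth[OF this]
    show "(\<forall>n::nat. n \<ge> 1 \<longrightarrow> norm (cocycle_iter \<Omega> T ?A (int n) \<theta> *v v) \<ge> \<beta> * r ^ n * norm v) \<or>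
        (\<forall>n::nat. n \<ge> 1 \<longrightarrow> norm (cocycle_iter \<Omega> T ?A (- int n) \<theta> *v v) \<ge> \<beta> * r ^ n * norm v)"
      by (elim disjE) auto
  qed
  then show "(T, ?A) \<in> UG \<Omega>"
    using SL by (simp only: UG_def mem_Collect_eq case_prod_conv)
qed

end
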